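(* Let $n>1$, $d>1$ be integers and let $P\in\mathbb{E}=\mathbb{R}[X_1,\dots,X_n]_d$ be a homogeneous polynomial of degree $d$ in $n$ variables. The distance from $P$ to the real discriminant $\Delta$ for the Bombieri norm satisfies $$\mathrm{dist}(P,\Delta)\le\min_{x\in\mathcal{S}^{n-1},\ \nabla^TP(x)=0}|P(x)|.$$ That is, the distance to the discriminant is at most the minimal absolute value of the critical values of $P$ on the unit sphere.
   Context: $\mathcal{S}^{n-1}$ is the unit sphere of $\mathbb{R}^n$. The Bombieri norm on $\mathbb{E}$ is the norm of the scalar product for which distinct monomials are orthogonal and $\|x^\alpha\|^2=\alpha!/d!$ for $|\alpha|=d$ (where $\alpha!=\prod_i\alpha_i!$). The real discriminant $\Delta\subset\mathbb{E}$ is the set of polynomials $Q\in\mathbb{E}$ for which there is $x\in\mathcal{S}^{n-1}$ with $Q(x)=0$ and $\nabla Q(x)=0$; $\mathrm{dist}(P,\Delta)=\inf_{Q\in\Delta}\|P-Q\|$. For $x\in\mathcal{S}^{n-1}$, $\nabla^TP(x)=\nabla P(x)-\langle x\mid\nabla P(x)\rangle x$; the points where it vanishes are the critical points of $P$ on the sphere. *)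

theory Defs
  imports "HOL-Analysis.Analysis" "HOL-Library.Poly_Mapping"
begin

text \<open>
  A polynomial in variables indexed by the finite type \<open>'n\<close> (so \<open>n = CARD('n)\<close>) is a finitely
  supported map from exponent vectors to coefficients, following the conventions of
  \<^theory>\<open>HOL-Library.Poly_Mapping\<close>.
\<close>

type_synonym 'n rpoly = "('n \<Rightarrow>\<^sub>0 nat) \<Rightarrow>\<^sub>0 real"

definition mdeg :: "('n::finite \<Rightarrow>\<^sub>0 nat) \<Rightarrow> nat" where
  "mdeg \<alpha> = (\<Sum>i\<in>UNIV. Poly_Mapping.lookup \<alpha> i)"

definition mfact :: "('n::finite \<Rightarrow>\<^sub>0 nat) \<Rightarrow> nat" where
  "mfact \<alpha> = (\<Prod>i\<in>UNIV. fact (Poly_Mapping.lookup \<alpha> i))"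

text \<open>The space of homogeneous polynomials of degree \<open>d\<close>; as a vector space it contains 0.\<close>

definition hom_polys :: "nat \<Rightarrow> 'n::finite rpoly set" where
  "hom_polys d = {P. \<forall>\<alpha>\<in>Poly_Mapping.keys P. mdeg \<alpha> = d}"

definition peval :: "'n::finite rpoly \<Rightarrow> real ^ 'n \<Rightarrow> real" where
  "peval P x =
    (\<Sum>\<alpha>\<in>Poly_Mapping.keys P.
      Poly_Mapping.lookup P \<alpha> * (\<Prod>i\<in>UNIV. (x $ i) ^ Poly_Mapping.lookup \<alpha> i))"

definition gradient :: "('a::real_inner \<Rightarrow> real) \<Rightarrow> 'a \<Rightarrow> 'a" where
  "gradient f x = (THE D. GDERIV f x :> D)"

lemma gradient_eqI:
  assumes "GDERIV f x :> D"
  shows "gradient f x = D"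
  unfolding gradient_def
proof (rule the_equality)
  show "GDERIV f x :> D" by (fact assms)
next
  fix D' assume "GDERIV f x :> D'"
  then have "(\<lambda>h. inner h D') = (\<lambda>h. inner h D)"
    using assms unfolding gderiv_def by (rule has_derivative_unique)
  then show "D' = D"
    by (metis inner_commute vector_eq_rdot)
qed

lemma GDERIV_gradient_peval: "GDERIV (peval P) x :> gradient (peval P) x"
proof -
  have "peval P differentiable at x"
    unfolding peval_def differentiable_def
    by (rule exI) (rule derivative_intros bounded_linear_imp_has_derivative
                        bounded_linear_vec_nth)+
  then obtain f' where f': "(peval P has_derivative f') (at x)"
    by (auto simp: differentiable_def)
  then have "f' = (\<lambda>h. inner h (adjoint f' 1))"
    using adjoint_works[OF has_derivative_linear[OF f'], of _ 1]
    by (simp add: inner_commute fun_eq_iff)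
  with f' have "GDERIV (peval P) x :> adjoint f' 1"
    by (simp add: gderiv_def)
  then show ?thesis
    using gradient_eqI by metis
qed

definition tangential_gradient :: "'n::finite rpoly \<Rightarrow> real ^ 'n \<Rightarrow> real ^ 'n" where
  "tangential_gradient P x =
    gradient (peval P) x - inner x (gradient (peval P) x) *\<^sub>R x"

definition sphere_critical_points :: "'n::finite rpoly \<Rightarrow> (real ^ 'n) set" where
  "sphere_critical_points P = {x \<in> sphere 0 1. tangential_gradient P x = 0}"

text \<open>
  The bilinear form that makes distinct monomials orthogonal and gives \<open>x\<^sup>\<alpha>\<close>
  the squared norm \<open>\<alpha>! / d!\<close>; meant for arguments in \<^term>\<open>hom_polys d\<close>.
\<close>

definition bombieri_inner :: "nat \<Rightarrow> 'n::finite rpoly \<Rightarrow> 'n rpoly \<Rightarrow> real" where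
  "bombieri_inner d P Q =
    (\<Sum>\<alpha>\<in>Poly_Mapping.keys P \<inter> Poly_Mapping.keys Q.
      Poly_Mapping.lookup P \<alpha> * Poly_Mapping.lookup Q \<alpha> * (real (mfact \<alpha>) / fact d))"

definition bombieri_norm :: "nat \<Rightarrow> 'n::finite rpoly \<Rightarrow> real" where
  "bombieri_norm d P = sqrt (bombieri_inner d P P)"

definition discriminant :: "nat \<Rightarrow> 'n::finite rpoly set" where
  "discriminant d =
    {Q \<in> hom_polys d. \<exists>x\<in>sphere 0 1. peval Q x = 0 \<and> gradient (peval Q) x = 0}"

lemma zero_in_discriminant: "0 \<in> (discriminant d :: 'n::finite rpoly set)"
proof -
  have ev: "peval (0 :: 'n rpoly) = (\<lambda>x. 0)"
    by (simp add: peval_def fun_eq_iff)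
  obtain x :: "real ^ 'n" where "norm x = 1"
    using vector_choose_size[of 1] by auto
  moreover have "gradient (peval (0 :: 'n rpoly)) x = 0"
    unfolding ev by (rule gradient_eqI) (rule GDERIV_const)
  ultimately show ?thesis
    by (auto simp: discriminant_def hom_polys_def ev intro!: bexI[of _ x])
qed

text \<open>
  For \<open>S = discriminant d\<close> the infimum is a genuine one: the set is nonempty by
  \<open>zero_in_discriminant\<close>, and norms are bounded below by 0.
\<close>

definition bombieri_dist :: "nat \<Rightarrow> 'n::finite rpoly \<Rightarrow> 'n rpoly set \<Rightarrow> real" where
  "bombieri_dist d P S = (INF Q\<in>S. bombieri_norm d (P - Q))"

end

theory Submission
  imports Defs
begin

text \<open>
  At a critical point \<open>x\<close> on the sphere, Euler's identity gives \<open>\<nabla>P(x) = d P(x) x\<close>. Hence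
  \<open>Q(y) = P(y) - P(x) \<langle>x, y\<rangle>\<^sup>d\<close> vanishes to second order at \<open>x\<close>, so it lies in the discriminant.
  By the multinomial theorem the Bombieri norm of \<open>\<langle>x, y\<rangle>\<^sup>d\<close> is \<open>(\<Sum>i. x\<^sub>i\<^sup>2)\<^bsup>d/2\<^esup> = 1\<close>, so the distance
  from \<open>P\<close> to \<open>Q\<close> is \<open>\<bar>P(x)\<bar>\<close>.
  The minimum is attained because the critical set is compact and contains the maximum points of
  \<open>P\<close> on the sphere.
\<close>

subsection \<open>The multinomial theorem\<close>

lemma finite_mdeg_eq: "finite {\<alpha> :: 'n::finite \<Rightarrow>\<^sub>0 nat. mdeg \<alpha> = d}"
proof (rule inj_on_finite)
  show "inj_on Poly_Mapping.lookup {\<alpha> :: 'n \<Rightarrow>\<^sub>0 nat. mdeg \<alpha> = d}"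
    by (simp add: inj_on_def lookup_inject)
  show "Poly_Mapping.lookup ` {\<alpha> :: 'n \<Rightarrow>\<^sub>0 nat. mdeg \<alpha> = d} \<subseteq> PiE UNIV (\<lambda>_. {..d})"
  proof -
    have "Poly_Mapping.lookup \<alpha> i \<le> mdeg \<alpha>" for \<alpha> :: "'n \<Rightarrow>\<^sub>0 nat" and i
      unfolding mdeg_def by (rule member_le_sum) auto
    then show ?thesis by auto
  qed
  show "finite (PiE (UNIV :: 'n set) (\<lambda>_. {..d}))"
    by (intro finite_PiE) auto
qed

lemma lookup_add_unit:
  "Poly_Mapping.lookup (\<alpha> + Poly_Mapping.single j 1) i
     = Poly_Mapping.lookup \<alpha> i + (if i = j then 1 else 0 :: nat)"
  by (auto simp: lookup_add lookup_single)

lemma mdeg_add_unit: "mdeg (\<alpha> + Poly_Mapping.single j 1) = Suc (mdeg \<alpha>)"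
  unfolding mdeg_def lookup_add_unit by (simp add: sum.distrib)

lemma mfact_add_unit:
  "mfact (\<alpha> + Poly_Mapping.single j 1) = mfact \<alpha> * Suc (Poly_Mapping.lookup \<alpha> j)"
proof -
  have "mfact (\<alpha> + Poly_Mapping.single j 1)
      = (\<Prod>i\<in>UNIV. fact (Poly_Mapping.lookup \<alpha> i)
                    * (if i = j then Suc (Poly_Mapping.lookup \<alpha> i) else 1))"
    unfolding mfact_def lookup_add_unit by (intro prod.cong) auto
  then show ?thesis
    by (simp add: mfact_def prod.distrib)
qed

lemma mfact_pos: "mfact \<alpha> > 0"
  by (simp add: mfact_def prod_pos)

lemma monomial_add_unit:
  fixes z :: "'n::finite \<Rightarrow> real"
  shows "(\<Prod>i\<in>UNIV. z i ^ Poly_Mapping.lookup (\<alpha> + Poly_Mapping.single j 1) i)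
       = (\<Prod>i\<in>UNIV. z i ^ Poly_Mapping.lookup \<alpha> i) * z j"
proof -
  have "(\<Prod>i\<in>UNIV. z i ^ Poly_Mapping.lookup (\<alpha> + Poly_Mapping.single j 1) i)
      = (\<Prod>i\<in>UNIV. z i ^ Poly_Mapping.lookup \<alpha> i * (if i = j then z i else 1))"
    unfolding lookup_add_unit by (intro prod.cong) auto
  then show ?thesis
    by (simp add: prod.distrib)
qed

text \<open>Induction on \<open>d\<close>. Multiplying the expansion by the sum of the
  \<open>z j\<close> sends a pair (\<alpha>, j) to the exponent vector \<beta> = \<alpha> + e_j,
  where e_j is \<open>Poly_Mapping.single j 1\<close>. The new coefficient of \<beta> collects all j
  that lead to it.\<close>

lemma multinomial:
  fixes z :: "'n::finite \<Rightarrow> real"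
  shows "(\<Sum>i\<in>UNIV. z i) ^ d
       = (\<Sum>\<alpha>\<in>{\<alpha>. mdeg \<alpha> = d}. fact d / real (mfact \<alpha>) * (\<Prod>i\<in>UNIV. z i ^ Poly_Mapping.lookup \<alpha> i))"
proof (induction d)
  case 0
  have "{\<alpha> :: 'n \<Rightarrow>\<^sub>0 nat. mdeg \<alpha> = 0} = {0}"
    by (auto simp: mdeg_def intro: poly_mapping_eqI)
  then show ?case
    by (simp add: mfact_def)
next
  case (Suc d)
  define mon where "mon \<alpha> = (\<Prod>i\<in>UNIV. z i ^ Poly_Mapping.lookup \<alpha> i)" for \<alpha>
  let ?D = "\<lambda>d. {\<alpha> :: 'n \<Rightarrow>\<^sub>0 nat. mdeg \<alpha> = d}"
  let ?u = "\<lambda>j. Poly_Mapping.single j (1::nat)"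
  \<comment> \<open>Raising the exponent at \<open>j\<close> by one multiplies \<alpha>! by exactly
    the new exponent, which the extra factor in the numerator cancels.\<close>
  have term_eq: "fact d / real (mfact \<alpha>) * mon \<alpha> * z j
      = fact d * real (Poly_Mapping.lookup (\<alpha> + ?u j) j) / real (mfact (\<alpha> + ?u j)) * mon (\<alpha> + ?u j)"
    for \<alpha> j
    using mfact_pos[of \<alpha>] unfolding mon_def mfact_add_unit monomial_add_unit
    by (simp add: lookup_add divide_simps del: of_nat_Suc mult_Suc_right)
  have "(\<Sum>i\<in>UNIV. z i) ^ Suc d = (\<Sum>\<alpha>\<in>?D d. fact d / real (mfact \<alpha>) * mon \<alpha>) * (\<Sum>j\<in>UNIV. z j)"
    using Suc by (simp add: mon_def)
  also have "\<dots> = (\<Sum>(\<alpha>, j)\<in>?D d \<times> UNIV. fact d / real (mfact \<alpha>) * mon \<alpha> * z j)"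
    by (simp add: sum_product sum.cartesian_product)
  \<comment> \<open>Reindexing by (\<beta>, j): positivity of \<beta> at j makes the truncated
    subtraction \<beta> - e_j a genuine inverse.\<close>
  also have "\<dots> = (\<Sum>(\<beta>, j)\<in>{(\<beta>, j). \<beta> \<in> ?D (Suc d) \<and> Poly_Mapping.lookup \<beta> j > 0}.
                  fact d * real (Poly_Mapping.lookup \<beta> j) / real (mfact \<beta>) * mon \<beta>)"
  proof -
    have minus_unit: "\<beta> - ?u j + ?u j = \<beta>" if "Poly_Mapping.lookup \<beta> j > 0" for \<beta> :: "'n \<Rightarrow>\<^sub>0 nat" and j
      using that by (intro poly_mapping_eqI)
        (auto simp: lookup_add lookup_minus lookup_single when_def)
    have "mdeg (\<beta> - ?u j) = d" if "Poly_Mapping.lookup \<beta> j > 0" "mdeg \<beta> = Suc d" for \<beta> :: "'n \<Rightarrow>\<^sub>0 nat" and j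
      using mdeg_add_unit[of "\<beta> - ?u j" j] minus_unit[OF that(1)] that(2) by simp
    with minus_unit show ?thesis
      by (intro sum.reindex_bij_witness[where i = "\<lambda>(\<beta>, j). (\<beta> - ?u j, j)" and j = "\<lambda>(\<alpha>, j). (\<alpha> + ?u j, j)"])
        (simp_all only: mdeg_add_unit lookup_add_unit term_eq split_paired_all prod.case mem_Collect_eq mem_Times_iff fst_conv snd_conv
          UNIV_I add_diff_cancel_right' simp_thms if_True add_gr_0 zero_less_one)
  qed
  \<comment> \<open>The added pairs have exponent 0 at j, and this exponent is a factor of the
    summand.\<close>
  also have "\<dots> = (\<Sum>(\<beta>, j)\<in>?D (Suc d) \<times> UNIV.
                  fact d * real (Poly_Mapping.lookup \<beta> j) / real (mfact \<beta>) * mon \<beta>)"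
    by (intro sum.mono_neutral_left) (auto simp: finite_mdeg_eq)
  also have "\<dots> = (\<Sum>\<beta>\<in>?D (Suc d). \<Sum>j\<in>UNIV.
                  fact d * real (Poly_Mapping.lookup \<beta> j) / real (mfact \<beta>) * mon \<beta>)"
    by (simp add: sum.cartesian_product)
  \<comment> \<open>The exponents of \<beta> add up to d + 1, which turns d! into (d + 1)!.\<close>
  also have "\<dots> = (\<Sum>\<beta>\<in>?D (Suc d). fact (Suc d) / real (mfact \<beta>) * mon \<beta>)"
  proof (intro sum.cong refl)
    fix \<beta> :: "'n \<Rightarrow>\<^sub>0 nat" assume "\<beta> \<in> ?D (Suc d)"
    then have "(\<Sum>j\<in>UNIV. real (Poly_Mapping.lookup \<beta> j)) = real (Suc d)"
      by (simp add: mdeg_def del: of_nat_Suc flip: of_nat_sum)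
    moreover have "(\<Sum>j\<in>UNIV. fact d * real (Poly_Mapping.lookup \<beta> j) / real (mfact \<beta>) * mon \<beta>)
        = fact d * (\<Sum>j\<in>UNIV. real (Poly_Mapping.lookup \<beta> j)) / real (mfact \<beta>) * mon \<beta>"
      by (simp add: sum_distrib_left sum_distrib_right sum_divide_distrib)
    ultimately show "(\<Sum>j\<in>UNIV. fact d * real (Poly_Mapping.lookup \<beta> j) / real (mfact \<beta>) * mon \<beta>)
        = fact (Suc d) / real (mfact \<beta>) * mon \<beta>"
      by (simp add: mult.commute)
  qed
  finally show ?case
    by (simp add: mon_def)
qed

subsection \<open>Polynomial functions and their gradients\<close>

text \<open>Coefficients vanish off the support, so polynomials with different supports can be
  evaluated over one common index set.\<close>

lemma peval_superset:
  assumes "finite S" "Poly_Mapping.keys P \<subseteq> S"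
  shows "peval P x
       = (\<Sum>\<alpha>\<in>S. Poly_Mapping.lookup P \<alpha> * (\<Prod>i\<in>UNIV. (x $ i) ^ Poly_Mapping.lookup \<alpha> i))"
  unfolding peval_def using assms
  by (intro sum.mono_neutral_left) (auto simp: in_keys_iff)

lemma peval_diff: "peval (P - Q) x = peval P x - peval Q x"
proof -
  let ?S = "Poly_Mapping.keys P \<union> Poly_Mapping.keys Q"
  have "Poly_Mapping.keys (P - Q) \<subseteq> ?S"
    by (auto simp: in_keys_iff lookup_minus)
  then show ?thesis
    by (simp add: peval_superset[of ?S] lookup_minus left_diff_distrib sum_subtractf)
qed

lemma continuous_on_peval: "continuous_on S (peval P)"
  unfolding peval_def by (intro continuous_intros)

text \<open>Explicit partial derivatives serve both the continuity of the gradient and Euler's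
  identity. Truncation of the exponent at 0 is harmless, since that term carries the factor
  0.\<close>

lemma gradient_peval_nth:
  fixes P :: "'n::finite rpoly"
  shows "gradient (peval P) x $ i = (\<Sum>\<alpha>\<in>Poly_Mapping.keys P. Poly_Mapping.lookup P \<alpha> *
    (real (Poly_Mapping.lookup \<alpha> i) * (x $ i) ^ (Poly_Mapping.lookup \<alpha> i - 1)
      * (\<Prod>j\<in>UNIV - {i}. (x $ j) ^ Poly_Mapping.lookup \<alpha> j)))" (is "_ = ?D i")
proof -
  let ?m = "\<lambda>\<alpha> i. real (Poly_Mapping.lookup \<alpha> i) * (x $ i) ^ (Poly_Mapping.lookup \<alpha> i - 1)
      * (\<Prod>j\<in>UNIV - {i}. (x $ j) ^ Poly_Mapping.lookup \<alpha> j)"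
  have mon: "((\<lambda>x. \<Prod>i\<in>UNIV. (x $ i) ^ Poly_Mapping.lookup \<alpha> i) has_derivative
      (\<lambda>h. \<Sum>i\<in>UNIV. h $ i * ?m \<alpha> i)) (at x)" for \<alpha> :: "'n \<Rightarrow>\<^sub>0 nat"
  proof -
    have "((\<lambda>x. (x $ i) ^ k) has_derivative (\<lambda>h. real k * (h $ i) * (x $ i) ^ (k - 1))) (at x)"
      for i k
      by (rule derivative_eq_intros bounded_linear_imp_has_derivative bounded_linear_vec_nth refl)+
    from has_derivative_prod[OF this] show ?thesis
      by (rule has_derivative_eq_rhs) (simp add: mult_ac)
  qed
  have "(peval P has_derivative (\<lambda>h. \<Sum>\<alpha>\<in>Poly_Mapping.keys P.
      Poly_Mapping.lookup P \<alpha> * (\<Sum>i\<in>UNIV. h $ i * ?m \<alpha> i))) (at x)"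
    unfolding peval_def by (intro has_derivative_sum has_derivative_mult_right mon)
  moreover have "(\<Sum>\<alpha>\<in>Poly_Mapping.keys P. Poly_Mapping.lookup P \<alpha> * (\<Sum>i\<in>UNIV. h $ i * ?m \<alpha> i))
      = inner h (\<chi> i. ?D i)" for h
    unfolding inner_vec_def sum_distrib_left by (subst sum.swap) (simp add: sum_distrib_left mult_ac)
  ultimately have "(peval P has_derivative (\<lambda>h. inner h (\<chi> i. ?D i))) (at x)"
    by simp
  then have "gradient (peval P) x = (\<chi> i. ?D i)"
    by (intro gradient_eqI) (simp add: gderiv_def)
  then show ?thesis by simp
qed

lemma continuous_on_gradient_peval: "continuous_on S (gradient (peval P))"
proof -
  have "continuous_on S (\<lambda>x. \<chi> i. gradient (peval P) x $ i)"
    unfolding gradient_peval_nth by (intro continuous_intros)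
  then show ?thesis by simp
qed

text \<open>Multiplying the i-th partial derivative of a monomial by x_i gives the monomial times
  its i-th exponent, and these exponents sum to \<open>d\<close>.\<close>

lemma euler_identity:
  fixes P :: "'n::finite rpoly"
  assumes "P \<in> hom_polys d"
  shows "inner x (gradient (peval P) x) = real d * peval P x"
proof -
  have mon: "x $ i * (real (Poly_Mapping.lookup \<alpha> i) * (x $ i) ^ (Poly_Mapping.lookup \<alpha> i - 1)
      * (\<Prod>j\<in>UNIV - {i}. (x $ j) ^ Poly_Mapping.lookup \<alpha> j))
    = real (Poly_Mapping.lookup \<alpha> i) * (\<Prod>j\<in>UNIV. (x $ j) ^ Poly_Mapping.lookup \<alpha> j)" for i \<alpha>
    by (cases "Poly_Mapping.lookup \<alpha> i") (simp_all add: prod.remove[of UNIV i])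
  have "inner x (gradient (peval P) x) = (\<Sum>i\<in>UNIV. \<Sum>\<alpha>\<in>Poly_Mapping.keys P. Poly_Mapping.lookup P \<alpha> *
     (real (Poly_Mapping.lookup \<alpha> i) * (\<Prod>j\<in>UNIV. (x $ j) ^ Poly_Mapping.lookup \<alpha> j)))"
    unfolding inner_vec_def gradient_peval_nth mon[symmetric]
    by (simp add: sum_distrib_left mult_ac)
  also have "\<dots> = (\<Sum>\<alpha>\<in>Poly_Mapping.keys P. real (mdeg \<alpha>) *
     (Poly_Mapping.lookup P \<alpha> * (\<Prod>j\<in>UNIV. (x $ j) ^ Poly_Mapping.lookup \<alpha> j)))"
    unfolding mdeg_def
    by (subst sum.swap) (simp add: sum_distrib_left sum_distrib_right mult_ac)
  also have "\<dots> = real d * peval P x"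
    using assms by (simp add: hom_polys_def peval_def sum_distrib_left)
  finally show ?thesis .
qed

text \<open>Only the radial part of the gradient survives, and Euler's identity supplies its
  coefficient.\<close>

lemma gradient_at_critical_point:
  assumes "P \<in> hom_polys d" "x \<in> sphere_critical_points P"
  shows "gradient (peval P) x = (real d * peval P x) *\<^sub>R x"
  using assms(2) euler_identity[OF assms(1), of x]
  by (simp add: sphere_critical_points_def tangential_gradient_def)

subsection \<open>The critical set on the sphere\<close>

text \<open>The zero set of a continuous map on the compact sphere is closed.\<close>

lemma compact_sphere_critical_points: "compact (sphere_critical_points P)"
proof -
  have "continuous_on (sphere 0 1) (tangential_gradient P)"
    unfolding tangential_gradient_def
    by (intro continuous_intros continuous_on_gradient_peval)
  then have "closed {x \<in> sphere 0 1. tangential_gradient P x \<in> {0}}"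
    by (intro continuous_closed_preimage[unfolded vimage_def Int_def Collect_mem_eq, simplified]
          closed_sphere) auto
  then have "closed (sphere 0 1 \<inter> sphere_critical_points P)"
    by (simp add: sphere_critical_points_def Int_def conj_ac)
  then have "compact (sphere 0 1 \<inter> (sphere 0 1 \<inter> sphere_critical_points P))"
    by (intro compact_Int_closed compact_sphere)
  moreover have "sphere 0 1 \<inter> (sphere 0 1 \<inter> sphere_critical_points P) = sphere_critical_points P"
    by (auto simp: sphere_critical_points_def)
  ultimately show ?thesis by simp
qed

text \<open>At a maximum point \<open>x\<close> on the sphere, differentiate along the great circle through \<open>x\<close> in the
  direction of the tangential gradient.\<close>

lemma sphere_critical_points_nonempty:
  fixes P :: "'n::finite rpoly"
  shows "sphere_critical_points P \<noteq> {}"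
proof -
  obtain b :: "real ^ 'n" where "norm b = 1"
    using vector_choose_size[of 1] by auto
  then have "sphere (0 :: real ^ 'n) 1 \<noteq> {}" by auto
  then obtain x where x: "norm x = 1" and max: "\<And>y. norm y = 1 \<Longrightarrow> peval P y \<le> peval P x"
    using continuous_attains_sup[OF compact_sphere _ continuous_on_peval, of "0 :: real ^ 'n" 1 P] by auto
  define g v where "g = gradient (peval P) x" and "v = tangential_gradient P x"
  have v: "v = g - inner x g *\<^sub>R x"
    by (simp add: g_def v_def tangential_gradient_def)
  have xx: "inner x x = 1" using x by (simp add: dot_square_norm)
  have xv: "inner x v = 0" by (simp add: v inner_diff_right xx)
  have "v = 0"
  proof (rule ccontr)
    assume "v \<noteq> 0"
    define u where "u = sgn v"
    have uu: "inner u u = 1" using \<open>v \<noteq> 0\<close> by (simp add: u_def dot_square_norm norm_sgn)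
    have xu: "inner x u = 0" by (simp add: u_def sgn_div_norm xv)
    \<comment> \<open>Since \<open>u\<close> is a unit vector orthogonal to \<open>x\<close>, this
      curve stays on the sphere; it passes through \<open>x\<close> at time 0 with velocity
      \<open>u\<close>.\<close>
    define \<gamma> where "\<gamma> t = cos t *\<^sub>R x + sin t *\<^sub>R u" for t
    have "norm (\<gamma> t) = 1" for t
      by (simp add: \<gamma>_def norm_eq_1 inner_add_left inner_add_right xx uu xu inner_commute[of u x]
          flip: power2_eq_square)
    then have le: "peval P (\<gamma> t) \<le> peval P (\<gamma> 0)" for t
      using max by (simp add: \<gamma>_def)
    have "(\<gamma> has_derivative (\<lambda>t. t *\<^sub>R u)) (at 0)"
      unfolding \<gamma>_def by (rule derivative_eq_intros refl | simp)+
    moreover have "(peval P has_derivative (\<lambda>h. inner h g)) (at (\<gamma> 0))"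
      using GDERIV_gradient_peval[of P x] by (simp add: gderiv_def g_def \<gamma>_def)
    ultimately have "((\<lambda>t. peval P (\<gamma> t)) has_derivative (\<lambda>t. inner (t *\<^sub>R u) g)) (at 0)"
      by (rule has_derivative_compose)
    then have "((\<lambda>t. peval P (\<gamma> t)) has_real_derivative inner u g) (at 0)"
      by (simp add: has_field_derivative_def mult_commute_abs)
    then have "inner u g = 0"
      by (rule DERIV_local_max[where d = 1]) (use le in auto)
    \<comment> \<open>The vectors \<open>v\<close> and \<open>g\<close> differ by a multiple of
      \<open>x\<close>, which is orthogonal to \<open>u\<close>. So the derivative along the curve,
      just shown to be 0, equals the positive number \<open>norm v\<close>.\<close>
    moreover have "inner u v = norm v"
      using \<open>v \<noteq> 0\<close> by (simp add: u_def sgn_div_norm dot_square_norm power2_eq_square)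
    moreover have "inner u v = inner u g"
      by (simp add: v inner_diff_right xu inner_commute[of u x])
    ultimately show False
      using \<open>v \<noteq> 0\<close> by simp
  qed
  then show ?thesis
    using x by (auto simp: v_def sphere_critical_points_def)
qed

subsection \<open>Powers of linear forms\<close>

text \<open>This is c <a, y>^d, given directly by its multinomial coefficients because the Bombieri
  norm is computed from coefficients.\<close>

definition linear_form_power :: "real \<Rightarrow> real ^ 'n::finite \<Rightarrow> nat \<Rightarrow> 'n rpoly" where
  "linear_form_power c a d = Abs_poly_mapping (\<lambda>\<alpha>. if mdeg \<alpha> = d
     then c * (fact d / real (mfact \<alpha>)) * (\<Prod>i\<in>UNIV. (a $ i) ^ Poly_Mapping.lookup \<alpha> i) else 0)"

lemma lookup_linear_form_power:
  "Poly_Mapping.lookup (linear_form_power c a d) \<alpha> = (if mdeg \<alpha> = d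
     then c * (fact d / real (mfact \<alpha>)) * (\<Prod>i\<in>UNIV. (a $ i) ^ Poly_Mapping.lookup \<alpha> i) else 0)"
  unfolding linear_form_power_def
  by (subst Abs_poly_mapping_inverse)
    (auto intro: finite_subset[OF _ finite_mdeg_eq[of d]] split: if_splits)

lemma keys_linear_form_power: "Poly_Mapping.keys (linear_form_power c a d) \<subseteq> {\<alpha>. mdeg \<alpha> = d}"
  by (auto simp: in_keys_iff lookup_linear_form_power split: if_splits)

lemma linear_form_power_in_hom_polys: "linear_form_power c a d \<in> hom_polys d"
  using keys_linear_form_power by (auto simp: hom_polys_def)

text \<open>The multinomial theorem for the numbers a_i y_i.\<close>

lemma peval_linear_form_power: "peval (linear_form_power c a d) y = c * inner a y ^ d"
  unfolding inner_vec_def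
  by (simp add: peval_superset[OF finite_mdeg_eq keys_linear_form_power] multinomial
      lookup_linear_form_power power_mult_distrib prod.distrib sum_distrib_left mult_ac)

text \<open>The weight \<alpha>!/d! cancels one of the two multinomial coefficients in each squared
  coefficient. What remains is c^2 times the multinomial expansion of <a, a>^d.\<close>

lemma bombieri_norm_linear_form_power:
  "bombieri_norm d (linear_form_power c a d) = \<bar>c\<bar> * norm a ^ d"
proof -
  let ?L = "linear_form_power c a d"
  have "bombieri_inner d ?L ?L = (\<Sum>\<alpha>\<in>{\<alpha>. mdeg \<alpha> = d}.
      Poly_Mapping.lookup ?L \<alpha> * Poly_Mapping.lookup ?L \<alpha> * (real (mfact \<alpha>) / fact d))"
    unfolding bombieri_inner_def using keys_linear_form_power
    by (intro sum.mono_neutral_left) (auto simp: finite_mdeg_eq in_keys_iff)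
  also have "\<dots> = c\<^sup>2 * (\<Sum>\<alpha>\<in>{\<alpha>. mdeg \<alpha> = d}. fact d / real (mfact \<alpha>)
      * (\<Prod>i\<in>UNIV. (a $ i * a $ i) ^ Poly_Mapping.lookup \<alpha> i))"
    unfolding sum_distrib_left
  proof (intro sum.cong refl)
    fix \<alpha> :: "'a \<Rightarrow>\<^sub>0 nat" assume "\<alpha> \<in> {\<alpha>. mdeg \<alpha> = d}"
    then show "Poly_Mapping.lookup ?L \<alpha> * Poly_Mapping.lookup ?L \<alpha> * (real (mfact \<alpha>) / fact d)
      = c\<^sup>2 * (fact d / real (mfact \<alpha>) * (\<Prod>i\<in>UNIV. (a $ i * a $ i) ^ Poly_Mapping.lookup \<alpha> i))"
      using mfact_pos[of \<alpha>]
      by (simp add: lookup_linear_form_power power_mult_distrib prod.distrib power2_eq_square field_simps)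
  qed
  also have "\<dots> = c\<^sup>2 * inner a a ^ d"
    by (simp add: inner_vec_def multinomial)
  also have "\<dots> = (\<bar>c\<bar> * norm a ^ d)\<^sup>2"
    by (simp add: dot_square_norm power_mult_distrib power_mult[symmetric] mult.commute)
  finally show ?thesis
    by (simp add: bombieri_norm_def)
qed

subsection \<open>The distance to the discriminant\<close>

text \<open>Norms are nonnegative, so the family is bounded below and its infimum lies below each
  member.\<close>

lemma bombieri_dist_le:
  assumes "Q \<in> S"
  shows "bombieri_dist d P S \<le> bombieri_norm d (P - Q)"
proof -
  have "bombieri_norm d R \<ge> 0" for R :: "'a rpoly"
    by (simp add: bombieri_norm_def bombieri_inner_def sum_nonneg)
  then show ?thesis
    unfolding bombieri_dist_def using assms by (intro cINF_lower bdd_belowI2[where m = 0])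
qed

text \<open>At \<open>x\<close> the two polynomials share the value P(x) and the gradient d P(x) x,
  so their difference is singular there.\<close>

lemma diff_linear_form_power_in_discriminant:
  assumes P: "P \<in> hom_polys d" and x: "x \<in> sphere_critical_points P"
  shows "P - linear_form_power (peval P x) x d \<in> discriminant d"
proof -
  let ?c = "peval P x"
  let ?Q = "P - linear_form_power ?c x d"
  have norm: "norm x = 1" using x by (simp add: sphere_critical_points_def)
  then have xx: "inner x x = 1" by (simp add: dot_square_norm)
  have hom: "?Q \<in> hom_polys d"
    using P linear_form_power_in_hom_polys[of ?c x d]
    by (fastforce simp: hom_polys_def in_keys_iff lookup_minus)
  have ev: "peval ?Q = (\<lambda>y. peval P y - ?c * inner x y ^ d)"
    by (simp add: fun_eq_iff peval_diff peval_linear_form_power)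
  have "(peval P has_derivative (\<lambda>h. inner h ((real d * ?c) *\<^sub>R x))) (at x)"
    using GDERIV_gradient_peval[of P x] by (simp add: gderiv_def gradient_at_critical_point[OF P x])
  \<comment> \<open>The chain rule leaves a power of <x, x>, which is 1.\<close>
  moreover have "((\<lambda>y. ?c * inner x y ^ d) has_derivative (\<lambda>h. inner h ((real d * ?c) *\<^sub>R x))) (at x)"
    by (rule derivative_eq_intros refl)+ (simp add: xx inner_commute fun_eq_iff)
  ultimately have "(peval ?Q has_derivative (\<lambda>h. inner h 0)) (at x)"
    unfolding ev by (auto dest: has_derivative_diff)
  then have "gradient (peval ?Q) x = 0"
    by (intro gradient_eqI) (simp add: gderiv_def)
  then show ?thesis
    using hom norm xx unfolding discriminant_def by (auto simp: ev intro!: bexI[of _ x])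
qed

text \<open>The first conjunct records that the infimum is attained, hence a true minimum.\<close>

theorem theorem5p3:
  fixes P :: "'n::finite rpoly" and d :: nat
  assumes "CARD('n) > 1" and "d > 1" and "P \<in> hom_polys d"
  shows "(INF x\<in>sphere_critical_points P. \<bar>peval P x\<bar>)
            \<in> (\<lambda>x. \<bar>peval P x\<bar>) ` sphere_critical_points P
       \<and> bombieri_dist d P (discriminant d)
            \<le> (INF x\<in>sphere_critical_points P. \<bar>peval P x\<bar>)"
proof
  have "compact ((\<lambda>x. \<bar>peval P x\<bar>) ` sphere_critical_points P)"
    by (intro compact_continuous_image continuous_intros continuous_on_peval
        compact_sphere_critical_points)
  then show "(INF x\<in>sphere_critical_points P. \<bar>peval P x\<bar>)
      \<in> (\<lambda>x. \<bar>peval P x\<bar>) ` sphere_critical_points P"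
    by (intro closed_contains_Inf compact_imp_closed bounded_imp_bdd_below compact_imp_bounded)
      (simp_all add: sphere_critical_points_nonempty)
  show "bombieri_dist d P (discriminant d) \<le> (INF x\<in>sphere_critical_points P. \<bar>peval P x\<bar>)"
  proof (rule cINF_greatest[OF sphere_critical_points_nonempty])
    fix x assume x: "x \<in> sphere_critical_points P"
    then have "norm x = 1" by (simp add: sphere_critical_points_def)
    \<comment> \<open>Subtracting the chosen point of the discriminant from \<open>P\<close> leaves
      the power of the linear form, of norm |P(x)| times \<open>norm x ^ d\<close>.\<close>
    then show "bombieri_dist d P (discriminant d) \<le> \<bar>peval P x\<bar>"
      using bombieri_dist_le[OF diff_linear_form_power_in_discriminant[OF assms(3) x], of d P]
      by (simp add: bombieri_norm_linear_form_power)
  qed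
qed

end
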